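(* Let $d$ and $k$ be positive integers. If $P$ and $Q$ are disjoint lattice $(d,k)$-polytopes, then $$d(P,Q)\geq\frac{1}{k^{2d-1}\bigl(\sqrt{d}\bigr)^{3d}}.$$
   Context: A polytope in $\mathbb{R}^d$ is the convex hull of a non-empty finite set of points. A lattice polytope is a polytope all of whose vertices belong to $\mathbb{Z}^d$. A lattice $(d,k)$-polytope is a lattice polytope (of any dimension) contained in the hypercube $[0,k]^d$. $d(P,Q)$ denotes the minimal Euclidean distance between a point of $P$ and a point of $Q$ (the letter $d$ alone denotes the dimension of the ambient space). *)

theory Defs
  imports "HOL-Analysis.Analysis"
begin

(* The library predicate polytope admits the empty set, so non-emptiness is required
   separately. The vertices of a polytope are its extreme points. *)
definition lattice_polytope :: "(real ^ 'n) set \<Rightarrow> bool" where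
  "lattice_polytope P \<longleftrightarrow>
     polytope P \<and> P \<noteq> {} \<and> (\<forall>v. v extreme_point_of P \<longrightarrow> (\<forall>i. v $ i \<in> \<int>))"

(* The ambient dimension d is CARD('n). *)
definition lattice_dk_polytope :: "nat \<Rightarrow> (real ^ 'n) set \<Rightarrow> bool" where
  "lattice_dk_polytope k P \<longleftrightarrow> lattice_polytope P \<and> P \<subseteq> cbox 0 (\<chi> i. real k)"

end

theory Submission
  imports Defs
begin

text \<open>
  Let \<open>p \<in> P\<close> and \<open>q \<in> Q\<close> realise the distance and put \<open>w = p - q\<close>. The points \<open>p\<close> and \<open>q\<close> lie
  in the faces of \<open>P\<close> and \<open>Q\<close> that \<open>w\<close> exposes, so for lattice vertices \<open>a\<close>, \<open>b\<close> of these faces the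
  vector \<open>a - b - w\<close> lies in the span of the lattice edge directions of the two faces, all of them
  orthogonal to \<open>w\<close>. Choose a basis of that span among these directions, add \<open>a - b\<close>, and complete
  by coordinate vectors to a basis of \<open>\<real>\<^sup>d\<close>. Its determinant is a non-zero integer, and it does not
  change when the row \<open>a - b\<close> is replaced by \<open>w\<close>. As the remaining entries are at most \<open>k\<close> in
  absolute value, the Leibniz formula gives \<open>1 \<le> d! k\<^sup>d\<^sup>-\<^sup>1 |w|\<close>.
\<close>

lemma det_in_Ints:
  fixes A :: "'a::comm_ring_1 ^ 'n ^ 'n"
  assumes "\<And>i j. A $ i $ j \<in> \<int>"
  shows "det A \<in> \<int>"
  unfolding det_def using assms by (intro Ints_sum Ints_mult Ints_prod) auto

text \<open>Every Leibniz term takes one entry from each row. A separate bound \<open>c i\<close>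
  for each row lets one short row contribute its own small factor.\<close>

lemma abs_det_le_fact_prod:
  fixes A :: "real ^ 'n ^ 'n"
  assumes "\<And>i j. \<bar>A $ i $ j\<bar> \<le> c i"
  shows "\<bar>det A\<bar> \<le> fact CARD('n) * (\<Prod>i\<in>UNIV. c i)"
proof -
  have "\<bar>det A\<bar> \<le> (\<Sum>p | p permutes (UNIV :: 'n set). \<bar>of_int (sign p) * (\<Prod>i\<in>UNIV. A $ i $ p i)\<bar>)"
    unfolding det_def by (rule sum_abs)
  also have "\<dots> \<le> (\<Sum>p | p permutes (UNIV :: 'n set). \<Prod>i\<in>UNIV. c i)"
  proof (rule sum_mono)
    fix p :: "'n \<Rightarrow> 'n"
    have "\<bar>of_int (sign p) * (\<Prod>i\<in>UNIV. A $ i $ p i)\<bar> = (\<Prod>i\<in>UNIV. \<bar>A $ i $ p i\<bar>)"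
      by (simp add: abs_mult sign_def abs_prod)
    also have "\<dots> \<le> (\<Prod>i\<in>UNIV. c i)"
      using assms by (intro prod_mono) auto
    finally show "\<bar>of_int (sign p) * (\<Prod>i\<in>UNIV. A $ i $ p i)\<bar> \<le> (\<Prod>i\<in>UNIV. c i)" .
  qed
  also have "\<dots> = fact CARD('n) * (\<Prod>i\<in>UNIV. c i)"
    by (simp add: card_permutations)
  finally show ?thesis .
qed

text \<open>Here \<open>w\<close> is the component of \<open>u\<close> orthogonal to
  \<open>span S\<close>. Of \<open>u\<close> only integrality enters: its row makes the determinant
  an integer and is exchanged for \<open>w\<close> before sizes are estimated.\<close>

lemma norm_orthogonal_residue_ge:
  fixes u w :: "real ^ 'n" and S :: "(real ^ 'n) set" and c :: real
  assumes "c \<ge> 1" "w \<noteq> 0"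
    and S_int: "\<And>x i. x \<in> S \<Longrightarrow> x $ i \<in> \<int>"
    and S_le: "\<And>x i. x \<in> S \<Longrightarrow> \<bar>x $ i\<bar> \<le> c"
    and u_int: "\<And>i. u $ i \<in> \<int>"
    and S_orth: "\<And>x. x \<in> S \<Longrightarrow> orthogonal w x"
    and diff: "u - w \<in> span S"
  shows "1 \<le> fact CARD('n) * c ^ (CARD('n) - 1) * norm w"
proof -
  obtain B where B: "B \<subseteq> S" "independent B" "S \<subseteq> span B"
    by (rule maximal_independent_subset)
  have diff_B: "u - w \<in> span B"
    using diff B(3) span_minimal[OF _ subspace_span] by blast
  have u_notin: "u \<notin> span B"
  proof
    assume "u \<in> span B"
    then have "w \<in> span B"
      using span_diff[OF _ diff_B] by fastforce
    moreover have "orthogonal w x" if "x \<in> B" for x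
      using that B(1) S_orth by blast
    ultimately have "orthogonal w w"
      by (rule orthogonal_to_span)
    with \<open>w \<noteq> 0\<close> show False
      by (simp add: orthogonal_self)
  qed
  then have "independent (insert u B)"
    using B(2) by (simp add: independent_insert)
  \<comment> \<open>Coordinate vectors keep the entries integral and, as \<open>c \<ge> 1\<close>,
    within the bound \<open>c\<close>.\<close>
  then obtain C where C: "insert u B \<subseteq> C" "C \<subseteq> insert u B \<union> Basis" "independent C"
      "insert u B \<union> Basis \<subseteq> span C"
    by (rule maximal_independent_subset_extend[OF Un_upper1])
  have span_C: "span C = UNIV"
    using C(4) span_minimal[OF _ subspace_span, of Basis C] by auto
  have "finite C"
    using C(3) by (rule independent_imp_finite)
  have "card C = CARD('n)"
    using dim_eq_card[of C UNIV] span_C C(3) by simp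
  then obtain f where f: "bij_betw f (UNIV :: 'n set) C"
    using \<open>finite C\<close> finite_same_card_bij[of "UNIV :: 'n set" C] by auto
  define A :: "real ^ 'n ^ 'n" where "A = (\<chi> i. f i)"
  have row_A: "row i A = f i" for i
    by (simp add: A_def row_def vec_eq_iff)
  obtain i0 where i0: "f i0 = u"
    using f C(1) by (auto simp: bij_betw_def)
  have f_cases: "f i \<in> B \<or> f i \<in> Basis" if "i \<noteq> i0" for i
  proof -
    have "f i \<in> C" "f i \<noteq> u"
      using f that i0 by (auto simp: bij_betw_def inj_on_def)
    then show ?thesis
      using C(2) by auto
  qed
  have "rows A = C"
    using f by (auto simp: rows_def row_A bij_betw_def)
  then have "det A \<noteq> 0"
    using span_C by (metis invertible_det_nz invertible_left_inverse matrix_left_invertible_span_rows)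
  moreover have "det A \<in> \<int>"
  proof (rule det_in_Ints)
    fix i j
    show "A $ i $ j \<in> \<int>"
    proof (cases "i = i0")
      case True
      then show ?thesis using u_int i0 by (simp add: A_def)
    next
      case False
      then show ?thesis
        using f_cases[OF False] B(1) S_int by (auto simp: A_def Basis_vec_def axis_def)
    qed
  qed
  ultimately have "1 \<le> \<bar>det A\<bar>"
    by (rule Ints_nonzero_abs_ge1[rotated])
  \<comment> \<open>Row \<open>i0\<close> is \<open>u\<close>, and \<open>w - u\<close> is a
    combination of the rows in \<open>B\<close>, all different from row \<open>i0\<close> because
    \<open>u\<close> is outside \<open>span B\<close>.\<close>
  also have "det A = det (\<chi> i. if i = i0 then row i0 A + (w - u) else row i A)"
  proof (rule det_row_span[symmetric])
    have "B \<subseteq> {row j A |j. j \<noteq> i0}"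
    proof
      fix x assume "x \<in> B"
      then have "x \<in> C" "x \<noteq> u"
        using C(1) u_notin span_base by auto
      then show "x \<in> {row j A |j. j \<noteq> i0}"
        using f i0 by (force simp: row_A bij_betw_def)
    qed
    moreover have "w - u \<in> span B"
      using span_neg[OF diff_B] by simp
    ultimately show "w - u \<in> vec.span {row j A |j. j \<noteq> i0}"
      using span_mono by (auto simp: span_vec_eq)
  qed
  also have "\<bar>\<dots>\<bar> \<le> fact CARD('n) * (\<Prod>i\<in>(UNIV :: 'n set). if i = i0 then norm w else c)"
  proof (rule abs_det_le_fact_prod)
    fix i j
    show "\<bar>(\<chi> i. if i = i0 then row i0 A + (w - u) else row i A) $ i $ j\<bar>
        \<le> (if i = i0 then norm w else c)"
      using f_cases[of i] subsetD[OF B(1), THEN S_le] \<open>c \<ge> 1\<close> component_le_norm_cart[of w j]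
      by (auto simp: row_A i0 Basis_vec_def axis_def)
  qed
  also have "\<dots> = fact CARD('n) * c ^ (CARD('n) - 1) * norm w"
    by (simp add: prod.remove[of UNIV i0] card_Diff_singleton)
  finally show ?thesis .
qed

text \<open>The minimisers of a linear functional over a polytope form a face. This face is again a
  polytope, hence the hull of its extreme points, and these are extreme in \<open>P\<close> as
  well.\<close>

lemma polytope_point_in_hull_supporting_vertices:
  fixes P :: "'a::euclidean_space set"
  assumes "polytope P" "p \<in> P" and w: "\<And>x. x \<in> P \<Longrightarrow> w \<bullet> p \<le> w \<bullet> x"
  shows "p \<in> convex hull {v. v extreme_point_of P \<and> w \<bullet> v = w \<bullet> p}"
proof -
  define F where "F = P \<inter> {x. w \<bullet> x = w \<bullet> p}"
  have face: "F face_of P"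
    unfolding F_def using assms
    by (intro face_of_Int_supporting_hyperplane_ge polytope_imp_convex) auto
  then have "polytope F"
    using assms(1) by (rule face_of_polytope_polytope[rotated])
  then have "F = convex hull {v. v extreme_point_of F}"
    by (intro Krein_Milman_Minkowski polytope_imp_compact polytope_imp_convex)
  moreover have "p \<in> F"
    using assms(2) by (simp add: F_def)
  moreover have "v extreme_point_of P \<and> w \<bullet> v = w \<bullet> p" if "v extreme_point_of F" for v
    using that extreme_point_of_face[OF face, of v] by (auto simp: F_def)
  then have "convex hull {v. v extreme_point_of F}
      \<subseteq> convex hull {v. v extreme_point_of P \<and> w \<bullet> v = w \<bullet> p}"
    by (intro hull_mono) auto
  ultimately show ?thesis
    by blast
qed

text \<open>The affine hull of \<open>E\<close>, which contains the convex hull, is \<open>a\<close>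
  plus the span of the differences.\<close>

lemma diff_in_span_of_convex_hull:
  fixes E :: "'a::real_vector set"
  assumes "p \<in> convex hull E" "a \<in> E"
  shows "p - a \<in> span ((\<lambda>x. x - a) ` E)"
proof -
  have "p \<in> affine hull E"
    using assms(1) convex_hull_subset_affine_hull by blast
  also have "affine hull E = (\<lambda>x. a + x) ` span ((\<lambda>x. - a + x) ` E)"
    by (rule affine_hull_span_gen) (simp add: assms(2) hull_inc)
  finally show ?thesis
    by auto
qed

lemma lattice_dk_polytope_setdist_ge:
  fixes P Q :: "(real ^ 'n) set"
  assumes "k > 0" and P: "lattice_dk_polytope k P" and Q: "lattice_dk_polytope k Q"
    and "P \<inter> Q = {}"
  shows "1 \<le> fact CARD('n) * real k ^ (CARD('n) - 1) * setdist P Q"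
proof -
  have poly: "polytope P" "P \<noteq> {}" "polytope Q" "Q \<noteq> {}"
    using P Q by (auto simp: lattice_dk_polytope_def lattice_polytope_def)
  have int: "v $ i \<in> \<int>" if "v extreme_point_of P \<or> v extreme_point_of Q" for v i
    using that P Q by (auto simp: lattice_dk_polytope_def lattice_polytope_def)
  have box: "0 \<le> x $ i \<and> x $ i \<le> real k" if "x \<in> P \<or> x \<in> Q" for x i
    using that P Q by (auto simp: lattice_dk_polytope_def mem_box_cart)
  \<comment> \<open>Both coordinates lie in the same interval from 0 to \<open>k\<close>, so edge
    directions have entries of size at most \<open>k\<close>.\<close>
  have diff_le: "\<bar>x $ i - y $ i\<bar> \<le> real k" if "x \<in> P \<or> x \<in> Q" "y \<in> P \<or> y \<in> Q" for x y i
    using box[OF that(1), of i] box[OF that(2), of i] by linarith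
  obtain p q where pq: "p \<in> P" "q \<in> Q" "dist p q = setdist P Q"
    using setdist_compact_closed[of P Q] poly
    by (auto intro: polytope_imp_compact polytope_imp_closed)
  define w where "w = p - q"
  have "w \<noteq> 0"
    using pq(1,2) \<open>P \<inter> Q = {}\<close> by (auto simp: w_def)
  \<comment> \<open>As \<open>p\<close> is a point of \<open>P\<close> closest to \<open>q\<close>,
    the angle at \<open>p\<close> between \<open>q - p\<close> and \<open>x - p\<close> is never
    acute. The same holds at \<open>q\<close> with \<open>- w\<close> in place of
    \<open>w\<close>.\<close>
  have w_P: "w \<bullet> p \<le> w \<bullet> x" if "x \<in> P" for x
  proof -
    have "(q - p) \<bullet> (x - p) \<le> 0"
      using poly pq that setdist_le_dist[of _ P q Q]
      by (intro any_closest_point_dot[of P]) (auto intro: polytope_imp_convex polytope_imp_closed simp: dist_commute)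
    then show ?thesis
      by (simp add: w_def algebra_simps)
  qed
  have w_Q: "(- w) \<bullet> q \<le> (- w) \<bullet> x" if "x \<in> Q" for x
  proof -
    have "(p - q) \<bullet> (x - q) \<le> 0"
      using poly pq that setdist_le_dist[of p P _ Q]
      by (intro any_closest_point_dot[of Q]) (auto intro: polytope_imp_convex polytope_imp_closed)
    then show ?thesis
      by (simp add: w_def algebra_simps)
  qed
  define E where "E = {v. v extreme_point_of P \<and> w \<bullet> v = w \<bullet> p}"
  define G where "G = {v. v extreme_point_of Q \<and> (- w) \<bullet> v = (- w) \<bullet> q}"
  have p_E: "p \<in> convex hull E"
    unfolding E_def using poly(1) pq(1) w_P by (rule polytope_point_in_hull_supporting_vertices)
  have q_G: "q \<in> convex hull G"
    unfolding G_def using poly(3) pq(2) w_Q by (rule polytope_point_in_hull_supporting_vertices)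
  obtain a b where ab: "a \<in> E" "b \<in> G"
    using p_E q_G by fastforce
  define S where "S = (\<lambda>x. x - a) ` E \<union> (\<lambda>x. x - b) ` G"
  have sub: "E \<subseteq> P" "G \<subseteq> Q"
    by (auto simp: E_def G_def extreme_point_of_def)
  have "1 \<le> fact CARD('n) * real k ^ (CARD('n) - 1) * norm w"
  proof (rule norm_orthogonal_residue_ge[where u = "a - b" and S = S])
    show "1 \<le> real k" "w \<noteq> 0"
      using \<open>k > 0\<close> \<open>w \<noteq> 0\<close> by auto
    show "x $ i \<in> \<int>" if "x \<in> S" for x i
      using that ab int by (auto simp: S_def E_def G_def)
    show "\<bar>x $ i\<bar> \<le> real k" if "x \<in> S" for x i
      using that ab sub by (auto simp: S_def intro!: diff_le)
    show "(a - b) $ i \<in> \<int>" for i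
      using ab int by (auto simp: E_def G_def)
    \<comment> \<open>The functional \<open>w\<close> is constant on \<open>E\<close> and constant
      on \<open>G\<close>, so it vanishes on differences within either set.\<close>
    show "orthogonal w x" if "x \<in> S" for x
      using that ab by (auto simp: S_def E_def G_def orthogonal_def algebra_simps)
    have "p - a \<in> span S" "q - b \<in> span S"
      using diff_in_span_of_convex_hull[OF p_E ab(1)] diff_in_span_of_convex_hull[OF q_G ab(2)]
        span_mono[of _ S] by (auto simp: S_def)
    then have "(q - b) - (p - a) \<in> span S"
      by (rule span_diff[rotated])
    then show "a - b - w \<in> span S"
      by (simp add: w_def algebra_simps)
  qed
  then show ?thesis
    using pq(3) by (simp add: w_def dist_norm)
qed

theorem theorem2p3:
  fixes P Q :: "(real ^ 'n) set" and k :: nat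
  assumes "k > 0"
    and "lattice_dk_polytope k P"
    and "lattice_dk_polytope k Q"
    and "P \<inter> Q = {}"
  shows "setdist P Q \<ge> 1 / (real k ^ (2 * CARD('n) - 1) * sqrt (real CARD('n)) ^ (3 * CARD('n)))"
proof -
  let ?d = "CARD('n)"
  have d: "real ?d \<ge> 1"
    by (simp add: Suc_leI)
  have "fact ?d \<le> real ?d ^ ?d"
    using fact_le_power[of ?d, where 'a = real] by simp
  \<comment> \<open>With d the dimension, \<open>sqrt d ^ 3\<close> equals
    \<open>d * sqrt d\<close>, which is at least d.\<close>
  also have "\<dots> \<le> (sqrt (real ?d) ^ 3) ^ ?d"
    using d mult_left_mono[of 1 "sqrt (real ?d)" "real ?d"]
    by (intro power_mono) (simp_all add: power3_eq_cube)
  finally have fact_le: "fact ?d \<le> sqrt (real ?d) ^ (3 * ?d)"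
    by (simp add: power_mult)
  \<comment> \<open>The exponent \<open>?d - 1\<close> obtained above is smaller than the one
    claimed, so the bound is only weakened here.\<close>
  have k_le: "real k ^ (?d - 1) \<le> real k ^ (2 * ?d - 1)"
    using \<open>k > 0\<close> by (intro power_increasing) auto
  have "1 \<le> fact ?d * real k ^ (?d - 1) * setdist P Q"
    using assms by (rule lattice_dk_polytope_setdist_ge)
  also have "\<dots> \<le> sqrt (real ?d) ^ (3 * ?d) * real k ^ (2 * ?d - 1) * setdist P Q"
    using fact_le k_le by (intro mult_right_mono mult_mono) auto
  finally show ?thesis
    using assms(1) d by (simp add: field_simps)
qed

end
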